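(* Let $M$ be an almost quaternion-Hermitian manifold of dimension $4n$, $n\ge2$, and let $I,J,K$ be a local adapted basis. With the one-forms $\lambda_A$ and the tensors $\alpha_A$ ($A=I,J,K$) defined from $\nabla\omega_I,\nabla\omega_J,\nabla\omega_K$ as in the context, the covariant derivative of $\omega_I$ is given by $$\nabla\omega_I=\lambda_K\otimes\omega_J-\lambda_J\otimes\omega_K+J_{(2)}\alpha_K-K_{(2)}\alpha_J.$$
   Context: An almost quaternion-Hermitian manifold is a smooth $4n$-manifold $M$ ($n\ge2$) with a Riemannian metric $g=\langle\cdot,\cdot\rangle$ and a rank-three subbundle of $\mathrm{End}\,TM$ which locally has an adapted basis $I,J,K$: $I^2=J^2=-1$, $K=IJ=-JI$, $\langle AX,AY\rangle=\langle X,Y\rangle$ for $A=I,J,K$. Put $\omega_A(X,Y)=\langle X,AY\rangle$; $\nabla$ is the Levi-Civita connection and $\nabla\omega_A$ is the $(0,3)$-tensor $(X,Y,Z)\mapsto(\nabla_X\omega_A)(Y,Z)$. For a $(0,s)$-tensor $b$ put $A_{(i)}b(X_1,\dots,X_i,\dots,X_s)=-b(X_1,\dots,AX_i,\dots,X_s)$, and let $\langle a,b\rangle=\sum a(e_{i_1},\dots,e_{i_s})b(e_{i_1},\dots,e_{i_s})$ over an orthonormal basis. Define $$\lambda_I(X)=\tfrac1{4n}\langle\nabla_X\omega_J,\omega_K\rangle=-\tfrac1{4n}\langle\nabla_X\omega_K,\omega_J\rangle,$$ $$\alpha_I=-\lambda_I\otimes g+\tfrac12(J_{(2)}-J_{(3)})\nabla\omega_K=-\lambda_I\otimes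 g+\tfrac12(K_{(3)}-K_{(2)})\nabla\omega_J,$$ (the two expressions agree in each case), and define $\lambda_J,\lambda_K,\alpha_J,\alpha_K$ by cyclic permutation of $I,J,K$. *)

theory Defs
  imports "HOL-Analysis.Analysis"
begin

section \<open>Smooth maps and smooth manifolds\<close>

text \<open>Meant for open \<open>S\<close> and a finite-dimensional domain, where a map is of class \<open>C\<^sup>k\<^sup>+\<^sup>1\<close> iff it is
  differentiable and all its directional derivatives are of class \<open>C\<^sup>k\<close>.\<close>

primrec C_on :: "nat \<Rightarrow> 'a::euclidean_space set \<Rightarrow> ('a \<Rightarrow> 'b::real_normed_vector) \<Rightarrow> bool" where
  "C_on 0 S f \<longleftrightarrow> continuous_on S f"
| "C_on (Suc k) S f \<longleftrightarrow>
     (\<forall>x\<in>S. f differentiable (at x)) \<and> (\<forall>v. C_on k S (\<lambda>x. frechet_derivative f (at x) v))"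

definition smooth_on :: "'a::euclidean_space set \<Rightarrow> ('a \<Rightarrow> 'b::real_normed_vector) \<Rightarrow> bool" where
  "smooth_on S f \<longleftrightarrow> (\<forall>k. C_on k S f)"

text \<open>A chart is a pair of a domain and a coordinate map; only the values of the map on the
  domain matter.\<close>

type_synonym ('m, 'e) chart = "'m set \<times> ('m \<Rightarrow> 'e)"

definition chart_image :: "('m, 'e) chart \<Rightarrow> 'm set \<Rightarrow> 'e set" where
  "chart_image c W = snd c ` (fst c \<inter> W)"

definition transition :: "('m, 'e) chart \<Rightarrow> ('m, 'e) chart \<Rightarrow> 'e \<Rightarrow> 'e" where
  "transition c d = snd d \<circ> inv_into (fst c) (snd c)"

definition is_chart :: "'m topology \<Rightarrow> ('m, 'e::euclidean_space) chart \<Rightarrow> bool" where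
  "is_chart M c \<longleftrightarrow> openin M (fst c) \<and> open (snd c ` fst c) \<and>
     homeomorphic_map (subtopology M (fst c)) (top_of_set (snd c ` fst c)) (snd c)"

text \<open>The atlas \<open>\<A>\<close> need not be maximal. The dimension of the manifold is that of the model space
  \<open>'e\<close>.\<close>

definition smooth_manifold :: "'m topology \<Rightarrow> ('m, 'e::euclidean_space) chart set \<Rightarrow> bool" where
  "smooth_manifold M \<A> \<longleftrightarrow>
     Hausdorff_space M \<and> second_countable M \<and>
     (\<forall>c\<in>\<A>. is_chart M c) \<and> (\<Union>c\<in>\<A>. fst c) = topspace M \<and>
     (\<forall>c\<in>\<A>. \<forall>d\<in>\<A>. smooth_on (chart_image c (fst d)) (transition c d))"


section \<open>Tensor fields\<close>

text \<open>A tensor field on \<open>M\<close> is given by its representatives in all the charts \<open>c\<close> of the atlas, as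
  functions of the coordinates \<open>x\<close>, related by the usual transformation law. A tangent vector at a
  point is represented in a chart around it by a vector of \<open>'e\<close>; the following map passes from the
  representative in the chart \<open>c\<close> to the one in \<open>d\<close>.\<close>

definition change_of_chart ::
  "('m, 'e::euclidean_space) chart \<Rightarrow> ('m, 'e) chart \<Rightarrow> 'm \<Rightarrow> 'e \<Rightarrow> 'e" where
  "change_of_chart c d p = frechet_derivative (transition c d) (at (snd c p))"

definition riemannian_metric ::
  "('m, 'e::euclidean_space) chart set \<Rightarrow> (('m, 'e) chart \<Rightarrow> 'e \<Rightarrow> 'e \<Rightarrow>\<^sub>L 'e \<Rightarrow>\<^sub>L real) \<Rightarrow> bool" where
  "riemannian_metric \<A> g \<longleftrightarrow>
     (\<forall>c\<in>\<A>. smooth_on (snd c ` fst c) (g c) \<and>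
        (\<forall>x\<in>snd c ` fst c. (\<forall>X Y. g c x X Y = g c x Y X) \<and> (\<forall>X. X \<noteq> 0 \<longrightarrow> g c x X X > 0))) \<and>
     (\<forall>c\<in>\<A>. \<forall>d\<in>\<A>. \<forall>p\<in>fst c \<inter> fst d. \<forall>X Y.
        g c (snd c p) X Y = g d (snd d p) (change_of_chart c d p X) (change_of_chart c d p Y))"

definition endomorphism_field ::
  "('m, 'e::euclidean_space) chart set \<Rightarrow> 'm set \<Rightarrow> (('m, 'e) chart \<Rightarrow> 'e \<Rightarrow> 'e \<Rightarrow>\<^sub>L 'e) \<Rightarrow> bool" where
  "endomorphism_field \<A> W A \<longleftrightarrow>
     (\<forall>c\<in>\<A>. smooth_on (chart_image c W) (A c)) \<and>
     (\<forall>c\<in>\<A>. \<forall>d\<in>\<A>. \<forall>p\<in>fst c \<inter> fst d \<inter> W. \<forall>X.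
        change_of_chart c d p (A c (snd c p) X) = A d (snd d p) (change_of_chart c d p X))"


section \<open>Almost quaternion-Hermitian manifolds\<close>

text \<open>\<open>G c x\<close> is the fibre, in the chart \<open>c\<close>, of a subbundle of \<open>End TM\<close> of rank three.\<close>

definition adapted_basis ::
  "'m topology \<Rightarrow> ('m, 'e::euclidean_space) chart set \<Rightarrow>
   (('m, 'e) chart \<Rightarrow> 'e \<Rightarrow> 'e \<Rightarrow>\<^sub>L 'e \<Rightarrow>\<^sub>L real) \<Rightarrow> (('m, 'e) chart \<Rightarrow> 'e \<Rightarrow> ('e \<Rightarrow>\<^sub>L 'e) set) \<Rightarrow>
   'm set \<Rightarrow> (('m, 'e) chart \<Rightarrow> 'e \<Rightarrow> 'e \<Rightarrow>\<^sub>L 'e) \<Rightarrow> (('m, 'e) chart \<Rightarrow> 'e \<Rightarrow> 'e \<Rightarrow>\<^sub>L 'e) \<Rightarrow>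
   (('m, 'e) chart \<Rightarrow> 'e \<Rightarrow> 'e \<Rightarrow>\<^sub>L 'e) \<Rightarrow> bool" where
  "adapted_basis M \<A> g G W I J K \<longleftrightarrow>
     openin M W \<and>
     endomorphism_field \<A> W I \<and> endomorphism_field \<A> W J \<and> endomorphism_field \<A> W K \<and>
     (\<forall>c\<in>\<A>. \<forall>x\<in>chart_image c W.
        span {I c x, J c x, K c x} = G c x \<and>
        I c x o\<^sub>L I c x = - id_blinfun \<and> J c x o\<^sub>L J c x = - id_blinfun \<and>
        K c x = I c x o\<^sub>L J c x \<and> K c x = - (J c x o\<^sub>L I c x) \<and>
        (\<forall>A\<in>{I, J, K}. \<forall>X Y. g c x (A c x X) (A c x Y) = g c x X Y))"

text \<open>The local frames \<open>I, J, K\<close>, being smooth tensor fields, make \<open>G\<close> a smooth subbundle that does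
  not depend on the chart.\<close>

definition almost_quaternion_hermitian ::
  "nat \<Rightarrow> 'm topology \<Rightarrow> ('m, 'e::euclidean_space) chart set \<Rightarrow>
   (('m, 'e) chart \<Rightarrow> 'e \<Rightarrow> 'e \<Rightarrow>\<^sub>L 'e \<Rightarrow>\<^sub>L real) \<Rightarrow> (('m, 'e) chart \<Rightarrow> 'e \<Rightarrow> ('e \<Rightarrow>\<^sub>L 'e) set) \<Rightarrow>
   bool" where
  "almost_quaternion_hermitian n M \<A> g G \<longleftrightarrow>
     n \<ge> 2 \<and> DIM('e) = 4 * n \<and> smooth_manifold M \<A> \<and> riemannian_metric \<A> g \<and>
     (\<forall>c\<in>\<A>. \<forall>x\<in>snd c ` fst c. subspace (G c x) \<and> dim (G c x) = 3) \<and>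
     (\<forall>p\<in>topspace M. \<exists>W I J K. p \<in> W \<and> adapted_basis M \<A> g G W I J K)"


section \<open>Levi-Civita connection\<close>

text \<open>From here on we compute in one chart: \<open>h\<close> is the metric and \<open>I, J, K\<close> are the adapted basis in
  that chart. A connection is given by \<open>\<nabla>\<^sub>X Y = D\<^sub>X Y + \<Gamma> x X Y\<close>; it is torsion-free iff \<open>\<Gamma> x\<close> is
  symmetric, and the last condition below says that it preserves \<open>h\<close>. By the fundamental theorem of
  Riemannian geometry there is exactly one such \<open>\<Gamma> x\<close>.\<close>

definition levi_civita_at ::
  "('e::euclidean_space \<Rightarrow> 'e \<Rightarrow>\<^sub>L 'e \<Rightarrow>\<^sub>L real) \<Rightarrow> 'e \<Rightarrow> ('e \<Rightarrow> 'e \<Rightarrow> 'e) \<Rightarrow> bool" where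
  "levi_civita_at h x \<Gamma> \<longleftrightarrow>
     bilinear \<Gamma> \<and> (\<forall>X Y. \<Gamma> X Y = \<Gamma> Y X) \<and>
     (\<forall>X Y Z. frechet_derivative (\<lambda>y. h y Y Z) (at x) X = h x (\<Gamma> X Y) Z + h x Y (\<Gamma> X Z))"

definition christoffel ::
  "('e::euclidean_space \<Rightarrow> 'e \<Rightarrow>\<^sub>L 'e \<Rightarrow>\<^sub>L real) \<Rightarrow> 'e \<Rightarrow> 'e \<Rightarrow> 'e \<Rightarrow> 'e" where
  "christoffel h x = (THE \<Gamma>. levi_civita_at h x \<Gamma>)"

text \<open>The covariant derivative of a \<open>(0,2)\<close>-tensor field; \<open>Y\<close> and \<open>Z\<close> are extended to constant
  vector fields in the chart.\<close>

definition nabla ::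
  "('e::euclidean_space \<Rightarrow> 'e \<Rightarrow>\<^sub>L 'e \<Rightarrow>\<^sub>L real) \<Rightarrow> ('e \<Rightarrow> 'e \<Rightarrow> 'e \<Rightarrow> real) \<Rightarrow>
   'e \<Rightarrow> 'e \<Rightarrow> 'e \<Rightarrow> 'e \<Rightarrow> real" where
  "nabla h b x X Y Z =
     frechet_derivative (\<lambda>y. b y Y Z) (at x) X
     - b x (christoffel h x X Y) Z - b x Y (christoffel h x X Z)"

definition omega ::
  "('e::euclidean_space \<Rightarrow> 'e \<Rightarrow>\<^sub>L 'e \<Rightarrow>\<^sub>L real) \<Rightarrow> ('e \<Rightarrow> 'e \<Rightarrow>\<^sub>L 'e) \<Rightarrow> 'e \<Rightarrow> 'e \<Rightarrow> 'e \<Rightarrow> real" where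
  "omega h A x X Y = h x X (A x Y)"


section \<open>The forms \<open>\<lambda>\<close> and the tensors \<open>\<alpha>\<close>\<close>

definition orthonormal_basis :: "('e::euclidean_space \<Rightarrow>\<^sub>L 'e \<Rightarrow>\<^sub>L real) \<Rightarrow> 'e set \<Rightarrow> bool" where
  "orthonormal_basis s B \<longleftrightarrow>
     span B = UNIV \<and> (\<forall>e\<in>B. \<forall>f\<in>B. s e f = (if e = f then 1 else 0))"

text \<open>The value does not depend on the orthonormal basis.\<close>

definition inner2 ::
  "('e::euclidean_space \<Rightarrow>\<^sub>L 'e \<Rightarrow>\<^sub>L real) \<Rightarrow> ('e \<Rightarrow> 'e \<Rightarrow> real) \<Rightarrow> ('e \<Rightarrow> 'e \<Rightarrow> real) \<Rightarrow> real" where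
  "inner2 s a b = (let B = (SOME B. orthonormal_basis s B) in \<Sum>e\<in>B. \<Sum>f\<in>B. a e f * b e f)"

text \<open>The operators \<open>A\<^sub>(\<^sub>2\<^sub>)\<close> and \<open>A\<^sub>(\<^sub>3\<^sub>)\<close> on \<open>(0,3)\<close>-tensors.\<close>

definition slot2 :: "('e \<Rightarrow> 'e) \<Rightarrow> ('e \<Rightarrow> 'e \<Rightarrow> 'e \<Rightarrow> real) \<Rightarrow> 'e \<Rightarrow> 'e \<Rightarrow> 'e \<Rightarrow> real" where
  "slot2 A b X Y Z = - b X (A Y) Z"

definition slot3 :: "('e \<Rightarrow> 'e) \<Rightarrow> ('e \<Rightarrow> 'e \<Rightarrow> 'e \<Rightarrow> real) \<Rightarrow> 'e \<Rightarrow> 'e \<Rightarrow> 'e \<Rightarrow> real" where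
  "slot3 A b X Y Z = - b X Y (A Z)"

text \<open>\<open>lambda_form n h I J K\<close> and \<open>alpha_form n h I J K\<close> are \<open>\<lambda>\<^sub>I\<close> and \<open>\<alpha>\<^sub>I\<close>; the forms with
  subscripts \<open>J\<close> and \<open>K\<close> are obtained by permuting the arguments \<open>I, J, K\<close> cyclically. (That is why
  the unused argument \<open>I\<close> is kept.)\<close>

definition lambda_form ::
  "nat \<Rightarrow> ('e::euclidean_space \<Rightarrow> 'e \<Rightarrow>\<^sub>L 'e \<Rightarrow>\<^sub>L real) \<Rightarrow>
   ('e \<Rightarrow> 'e \<Rightarrow>\<^sub>L 'e) \<Rightarrow> ('e \<Rightarrow> 'e \<Rightarrow>\<^sub>L 'e) \<Rightarrow> ('e \<Rightarrow> 'e \<Rightarrow>\<^sub>L 'e) \<Rightarrow> 'e \<Rightarrow> 'e \<Rightarrow> real" where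
  "lambda_form n h I J K x X =
     1 / (4 * real n) * inner2 (h x) (nabla h (omega h J) x X) (omega h K x)"

definition alpha_form ::
  "nat \<Rightarrow> ('e::euclidean_space \<Rightarrow> 'e \<Rightarrow>\<^sub>L 'e \<Rightarrow>\<^sub>L real) \<Rightarrow>
   ('e \<Rightarrow> 'e \<Rightarrow>\<^sub>L 'e) \<Rightarrow> ('e \<Rightarrow> 'e \<Rightarrow>\<^sub>L 'e) \<Rightarrow> ('e \<Rightarrow> 'e \<Rightarrow>\<^sub>L 'e) \<Rightarrow> 'e \<Rightarrow> 'e \<Rightarrow> 'e \<Rightarrow> 'e \<Rightarrow> real" where
  "alpha_form n h I J K x X Y Z =
     - lambda_form n h I J K x X * h x Y Z
     + 1 / 2 * (slot2 (J x) (nabla h (omega h K) x) X Y Z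
                - slot3 (J x) (nabla h (omega h K) x) X Y Z)"

end

theory Submission
  imports Defs
begin

text \<open>Fix \<open>X\<close> and write \<open>A' = \<nabla>\<^sub>X A\<close>, so that \<open>(\<nabla>\<^sub>X \<omega>\<^sub>A)(Y, Z) = \<langle>Y, A' Z\<rangle>\<close> since the
  Levi-Civita connection preserves the metric. The terms with \<open>\<lambda>\<^sub>J\<close> and \<open>\<lambda>\<^sub>K\<close> cancel against the trace
  parts of \<open>\<alpha>\<^sub>J\<close> and \<open>\<alpha>\<^sub>K\<close>, whatever the values of these forms, and what remains is
  \<open>I' + K I' K = J' K - K J'\<close>. This follows by applying the derivation \<open>\<nabla>\<^sub>X\<close> to \<open>J\<^sup>2 = K\<^sup>2 = -1\<close> and
  \<open>I = J K\<close>.\<close>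

section \<open>The Levi-Civita connection in a chart\<close>

lemma smooth_on_differentiable:
  assumes "smooth_on S f" "x \<in> S"
  shows "f differentiable (at x)"
proof -
  have "C_on (Suc 0) S f"
    using assms(1) unfolding smooth_on_def by (rule spec)
  then show ?thesis using assms(2) by simp
qed

text \<open>Quaternionic identities are given pointwise on the coordinate image of \<open>W\<close>.
  Openness of this image is what allows them to be differentiated at a point.\<close>

lemma open_chart_image:
  assumes "is_chart M c" "openin M W"
  shows "open (chart_image c W)"
proof -
  have "openin (subtopology M (fst c)) (fst c \<inter> W)"
    using assms(2) by (metis openin_subtopology_Int2)
  then have "openin (top_of_set (snd c ` fst c)) (snd c ` (fst c \<inter> W))"
    using assms(1) homeomorphic_imp_open_map unfolding is_chart_def open_map_def by blast
  then show ?thesis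
    using assms(1) unfolding is_chart_def chart_image_def by (metis openin_open_eq)
qed

text \<open>Riesz representation for \<open>s\<close>: the map \<open>T\<close> expresses
  \<open>s\<close> through the Euclidean inner product. Positivity makes it injective, hence
  surjective in finite dimension.\<close>

lemma nondegenerate_representation:
  fixes s :: "'e::euclidean_space \<Rightarrow>\<^sub>L 'e \<Rightarrow>\<^sub>L real"
  assumes pos: "\<And>X. X \<noteq> 0 \<Longrightarrow> s X X > 0" and \<phi>: "linear (\<phi> :: 'e \<Rightarrow> real)"
  obtains v where "\<And>Z. s v Z = \<phi> Z"
proof -
  define T where "T Y = (\<Sum>b\<in>Basis. s Y b *\<^sub>R b)" for Y
  have T: "T Y \<bullet> Z = s Y Z" for Y Z
  proof -
    have "s Y Z = s Y (\<Sum>b\<in>Basis. (Z \<bullet> b) *\<^sub>R b)"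
      by (simp add: euclidean_representation)
    also have "\<dots> = (\<Sum>b\<in>Basis. (Z \<bullet> b) * s Y b)"
      by (simp add: blinfun.sum_right blinfun.scaleR_right)
    also have "\<dots> = T Y \<bullet> Z"
      by (simp add: T_def inner_sum_left inner_sum_right inner_commute[of _ Z] mult.commute)
    finally show ?thesis by simp
  qed
  have "linear T"
    unfolding T_def
    by (intro linearI)
      (simp_all add: blinfun.add_left blinfun.add_right blinfun.scaleR_left blinfun.scaleR_right
        scaleR_left_distrib sum.distrib scaleR_sum_right)
  moreover have "inj T"
    unfolding linear_injective_0[OF \<open>linear T\<close>] using T pos
    by (metis inner_zero_left less_irrefl)
  ultimately have "surj T"
    by (simp add: linear_injective_imp_surjective)
  then obtain v where v: "T v = (\<Sum>b\<in>Basis. \<phi> b *\<^sub>R b)" by (metis surjD)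
  have "s v Z = \<phi> Z" for Z
  proof -
    have "\<phi> Z = \<phi> (\<Sum>b\<in>Basis. (Z \<bullet> b) *\<^sub>R b)"
      by (simp add: euclidean_representation)
    also have "\<dots> = (\<Sum>b\<in>Basis. (Z \<bullet> b) * \<phi> b)"
      by (simp add: linear_sum[OF \<phi>] linear_cmul[OF \<phi>])
    also have "\<dots> = T v \<bullet> Z"
      by (simp add: v inner_sum_left inner_sum_right inner_commute[of _ Z] mult.commute)
    finally show ?thesis using T by simp
  qed
  then show ?thesis by (rule that)
qed

lemma nondegenerate_eqI:
  fixes s :: "'e::euclidean_space \<Rightarrow>\<^sub>L 'e \<Rightarrow>\<^sub>L real"
  assumes pos: "\<And>X. X \<noteq> 0 \<Longrightarrow> s X X > 0" and eq: "\<And>Z. s u Z = s v Z"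
  shows "u = v"
proof -
  have "s (u - v) (u - v) = 0" by (simp add: blinfun.diff_left blinfun.diff_right eq)
  then show ?thesis using pos[of "u - v"] by fastforce
qed

lemma frechet_derivative_blinfun_apply2:
  fixes h :: "'e::euclidean_space \<Rightarrow> 'e \<Rightarrow>\<^sub>L 'e \<Rightarrow>\<^sub>L real"
  assumes "(h has_derivative h') (at x)"
  shows "frechet_derivative (\<lambda>y. h y Y Z) (at x) = (\<lambda>X. h' X Y Z)"
proof -
  have "((\<lambda>y. h y Y Z) has_derivative (\<lambda>X. h' X Y Z)) (at x)"
    by (rule derivative_eq_intros assms | simp)+
  then show ?thesis by (rule frechet_derivative_at[symmetric])
qed

text \<open>Koszul formula: symmetry and compatibility determine
  \<open>h x (\<Gamma> X Y) Z\<close>. The bracket terms are absent because constant vector fields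
  commute.\<close>

lemma levi_civita_unique:
  fixes h :: "'e::euclidean_space \<Rightarrow> 'e \<Rightarrow>\<^sub>L 'e \<Rightarrow>\<^sub>L real"
  assumes pos: "\<And>X. X \<noteq> 0 \<Longrightarrow> h x X X > 0" and sym: "\<And>X Y. h x X Y = h x Y X"
    and "levi_civita_at h x \<Gamma>" "levi_civita_at h x \<Delta>"
  shows "\<Gamma> = \<Delta>"
proof (intro ext nondegenerate_eqI[of "h x", OF pos])
  fix X Y Z
  have koszul: "2 * h x (\<Theta> X Y) Z = frechet_derivative (\<lambda>y. h y Y Z) (at x) X
      + frechet_derivative (\<lambda>y. h y X Z) (at x) Y - frechet_derivative (\<lambda>y. h y X Y) (at x) Z"
    if "levi_civita_at h x \<Theta>" for \<Theta>
  proof -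
    have s: "\<Theta> U V = \<Theta> V U" and
      d: "frechet_derivative (\<lambda>y. h y V W) (at x) U = h x (\<Theta> U V) W + h x V (\<Theta> U W)" for U V W
      using that unfolding levi_civita_at_def by blast+
    show ?thesis
      unfolding d using s[of Y X] s[of Z X] s[of Z Y] sym[of Y "\<Theta> X Z"] sym[of X "\<Theta> Y Z"]
      by simp
  qed
  show "h x (\<Gamma> X Y) Z = h x (\<Delta> X Y) Z"
    using koszul[OF assms(3)] koszul[OF assms(4)] by simp
qed

lemma levi_civita_exists:
  fixes h :: "'e::euclidean_space \<Rightarrow> 'e \<Rightarrow>\<^sub>L 'e \<Rightarrow>\<^sub>L real"
  assumes diff: "h differentiable (at x)"
    and S: "open S" "x \<in> S" and sym: "\<And>y X Y. y \<in> S \<Longrightarrow> h y X Y = h y Y X"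
    and pos: "\<And>X. X \<noteq> 0 \<Longrightarrow> h x X X > 0"
  obtains \<Gamma> where "levi_civita_at h x \<Gamma>"
proof -
  obtain h' where h': "(h has_derivative h') (at x)"
    using diff unfolding differentiable_def by blast
  note fd = frechet_derivative_blinfun_apply2[OF h']
  interpret h': bounded_linear h' using h' by (rule has_derivative_bounded_linear)
  \<comment> \<open>The symmetry of the metric on a whole neighbourhood passes to its
    derivative.\<close>
  have h'_sym: "h' X Y Z = h' X Z Y" for X Y Z
  proof -
    have "((\<lambda>y. h y Y Z) has_derivative (\<lambda>X. h' X Y Z)) (at x)"
      by (rule derivative_eq_intros h' | simp)+
    then have "((\<lambda>y. h y Z Y) has_derivative (\<lambda>X. h' X Y Z)) (at x)"
      by (rule has_derivative_transform_within_open[OF _ S]) (rule sym)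
    then show ?thesis using fd[of Z Y] frechet_derivative_at by metis
  qed
  \<comment> \<open>Half the right-hand side of the Koszul formula, now read as the definition of
    the connection.\<close>
  define \<phi> where "\<phi> X Y Z = (h' X Y Z + h' Y X Z - h' Z X Y) / 2" for X Y Z
  note lin = h'.add h'.scaleR blinfun.add_left blinfun.add_right blinfun.scaleR_left
    blinfun.scaleR_right
  have "linear (\<phi> X Y)" for X Y
    by (intro linearI) (simp_all add: \<phi>_def lin algebra_simps add_divide_distrib diff_divide_distrib)
  then have "\<exists>v. \<forall>Z. h x v Z = \<phi> X Y Z" for X Y
    using nondegenerate_representation[of "h x", OF pos] by metis
  then obtain \<Gamma> where \<Gamma>: "\<And>X Y Z. h x (\<Gamma> X Y) Z = \<phi> X Y Z" by metis
  have "bilinear \<Gamma>"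
    unfolding bilinear_def
    by (intro conjI allI linearI; rule nondegenerate_eqI[of "h x", OF pos])
      (simp_all add: \<Gamma> \<phi>_def lin algebra_simps add_divide_distrib diff_divide_distrib)
  moreover have "\<Gamma> X Y = \<Gamma> Y X" for X Y
    by (rule nondegenerate_eqI[of "h x", OF pos]) (simp_all add: \<Gamma> \<phi>_def h'_sym[of _ X Y])
  \<comment> \<open>In \<open>\<phi> X Y Z + \<phi> X Z Y\<close> the derivatives in the directions
    \<open>Y\<close> and \<open>Z\<close> cancel.\<close>
  moreover have "h' X Y Z = h x (\<Gamma> X Y) Z + h x Y (\<Gamma> X Z)" for X Y Z
    unfolding sym[OF S(2), of Y] \<Gamma> \<phi>_def using h'_sym[of X Y Z] h'_sym[of Y X Z] h'_sym[of Z X Y]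
    by (simp add: field_simps)
  ultimately have "levi_civita_at h x \<Gamma>"
    unfolding levi_civita_at_def fd by blast
  then show ?thesis by (rule that)
qed

text \<open>Existence and uniqueness justify the definite description in
  \<open>christoffel\<close>.\<close>

lemma levi_civita_christoffel:
  fixes h :: "'e::euclidean_space \<Rightarrow> 'e \<Rightarrow>\<^sub>L 'e \<Rightarrow>\<^sub>L real"
  assumes "h differentiable (at x)"
    and "open S" "x \<in> S" and "\<And>y X Y. y \<in> S \<Longrightarrow> h y X Y = h y Y X"
    and "\<And>X. X \<noteq> 0 \<Longrightarrow> h x X X > 0"
  shows "levi_civita_at h x (christoffel h x)"
proof -
  obtain \<Gamma> where \<Gamma>: "levi_civita_at h x \<Gamma>"
    using levi_civita_exists[of h x S] assms by blast
  show ?thesis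
    unfolding christoffel_def
  proof (rule theI[of "levi_civita_at h x", OF \<Gamma>])
    show "\<Delta> = \<Gamma>" if "levi_civita_at h x \<Delta>" for \<Delta>
      by (rule levi_civita_unique[OF assms(5) assms(4)[OF assms(3)] that \<Gamma>])
  qed
qed

section \<open>Covariant derivatives of endomorphism fields\<close>

text \<open>\<open>\<nabla>\<^sub>X A\<close>, where \<open>\<Gamma>\<close> is the endomorphism \<open>\<Gamma> X\<close> and \<open>A'\<close> is the derivative of \<open>A\<close> in
  direction \<open>X\<close>.\<close>

definition cov_deriv ::
  "('e::euclidean_space \<Rightarrow>\<^sub>L 'e) \<Rightarrow> ('e \<Rightarrow>\<^sub>L 'e) \<Rightarrow> ('e \<Rightarrow>\<^sub>L 'e) \<Rightarrow> 'e \<Rightarrow>\<^sub>L 'e" where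
  "cov_deriv \<Gamma> A A' = A' + (\<Gamma> o\<^sub>L A) - (A o\<^sub>L \<Gamma>)"

lemmas blinfun_apply_simps = blinfun.add_left blinfun.add_right blinfun.diff_left
  blinfun.diff_right blinfun.minus_left blinfun.minus_right

text \<open>Leibniz rule: the commutator with \<Gamma> is a derivation, since the two terms
  \<open>A \<Gamma> B\<close> cancel.\<close>

lemma cov_deriv_compose:
  "cov_deriv \<Gamma> (A o\<^sub>L B) ((A' o\<^sub>L B) + (A o\<^sub>L B')) =
     (cov_deriv \<Gamma> A A' o\<^sub>L B) + (A o\<^sub>L cov_deriv \<Gamma> B B')"
  by (rule blinfun_eqI) (simp add: cov_deriv_def blinfun_apply_simps algebra_simps)

lemma cov_deriv_minus_id: "cov_deriv \<Gamma> (- id_blinfun) 0 = 0"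
  by (rule blinfun_eqI) (simp add: cov_deriv_def blinfun_apply_simps algebra_simps)

text \<open>Uniqueness of the derivative identifies \<open>C'\<close> with the product rule for
  \<open>A\<close> and \<open>B\<close>. Taking \<open>C\<close> constant covers the squares of
  almost complex structures.\<close>

lemma cov_deriv_eq_compose:
  fixes A B C :: "'e::euclidean_space \<Rightarrow> 'e \<Rightarrow>\<^sub>L 'e"
  assumes A: "(A has_derivative A') (at x)" and B: "(B has_derivative B') (at x)"
    and C: "(C has_derivative C') (at x)"
    and S: "open S" "x \<in> S" and eq: "\<And>y. y \<in> S \<Longrightarrow> C y = A y o\<^sub>L B y"
  shows "cov_deriv \<Gamma> (C x) (C' X) =
     (cov_deriv \<Gamma> (A x) (A' X) o\<^sub>L B x) + (A x o\<^sub>L cov_deriv \<Gamma> (B x) (B' X))"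
proof -
  have "((\<lambda>y. A y o\<^sub>L B y) has_derivative (\<lambda>X. (A x o\<^sub>L B' X) + (A' X o\<^sub>L B x))) (at x)"
    by (rule bounded_bilinear.FDERIV[OF bounded_bilinear_blinfun_compose A B])
  then have "(C has_derivative (\<lambda>X. (A x o\<^sub>L B' X) + (A' X o\<^sub>L B x))) (at x)"
    by (rule has_derivative_transform_within_open[OF _ S]) (simp add: eq)
  then have "C' X = (A' X o\<^sub>L B x) + (A x o\<^sub>L B' X)"
    using has_derivative_unique[OF C] by (simp add: add.commute)
  then show ?thesis by (simp add: eq[OF S(2)] cov_deriv_compose)
qed

text \<open>Differentiate \<open>h y Y (A y Z)\<close> by the product rule and replace the
  derivative of \<open>h\<close> using compatibility. The term with \<Gamma> applied to
  \<open>Y\<close> cancels, and the rest is the commutator form of the covariant derivative.\<close>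

lemma nabla_omega:
  fixes h :: "'e::euclidean_space \<Rightarrow> 'e \<Rightarrow>\<^sub>L 'e \<Rightarrow>\<^sub>L real"
  assumes h: "h differentiable (at x)" and A: "(A has_derivative A') (at x)"
    and lc: "levi_civita_at h x (christoffel h x)"
  shows "nabla h (omega h A) x X Y Z =
    h x Y (cov_deriv (Blinfun (christoffel h x X)) (A x) (A' X) Z)"
proof -
  obtain h' where h': "(h has_derivative h') (at x)"
    using h unfolding differentiable_def by blast
  have "linear (christoffel h x X)"
    using lc unfolding levi_civita_at_def bilinear_def by blast
  \<comment> \<open>\<open>Blinfun\<close> is meaningful only on bounded linear maps; in finite
    dimension linearity suffices.\<close>
  then have \<Gamma>: "blinfun_apply (Blinfun (christoffel h x X)) = christoffel h x X"
    by (simp add: bounded_linear_Blinfun_apply linear_conv_bounded_linear)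
  have compat: "h' X Y V = h x (christoffel h x X Y) V + h x Y (christoffel h x X V)" for V
    using lc unfolding levi_civita_at_def frechet_derivative_blinfun_apply2[OF h'] by blast
  have "((\<lambda>y. omega h A y Y Z) has_derivative (\<lambda>X. h' X Y (A x Z) + h x Y (A' X Z))) (at x)"
    unfolding omega_def by (rule derivative_eq_intros h' A | simp add: add.commute)+
  then have "frechet_derivative (\<lambda>y. omega h A y Y Z) (at x) X = h' X Y (A x Z) + h x Y (A' X Z)"
    by (simp only: frechet_derivative_at[symmetric])
  then show ?thesis
    by (simp add: nabla_def omega_def compat cov_deriv_def \<Gamma> blinfun_apply_simps)
qed

lemma skew_of_orthogonal:
  fixes A :: "'e::euclidean_space \<Rightarrow>\<^sub>L 'e" and s :: "'e \<Rightarrow>\<^sub>L 'e \<Rightarrow>\<^sub>L real"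
  assumes "A o\<^sub>L A = - id_blinfun" and "\<And>X Y. s (A X) (A Y) = s X Y"
  shows "s (A X) Y = - s X (A Y)"
proof -
  have "A (A X) = - X"
    using arg_cong[OF assms(1), of "\<lambda>B. blinfun_apply B X"] by (simp add: blinfun_apply_simps)
  then show ?thesis using assms(2)[of "A X" Y] by (simp add: blinfun_apply_simps)
qed

text \<open>Substituting \<open>i'\<close> into \<open>k i' k\<close> gives
  \<open>- k j' + k j k' k\<close>. The last term equals \<open>- i k' k = i k k' = - j k'\<close>,
  which cancels the \<open>j k'\<close> in \<open>i'\<close>, so \<open>k'\<close> is
  eliminated.\<close>

lemma quaternion_derivation_identity:
  fixes i j k i' j' k' :: "'e::euclidean_space \<Rightarrow>\<^sub>L 'e"
  assumes jj: "j o\<^sub>L j = - id_blinfun" and kk: "k o\<^sub>L k = - id_blinfun"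
    and kj: "k o\<^sub>L j = - i" and ik: "i o\<^sub>L k = - j"
    and i': "i' = (j' o\<^sub>L k) + (j o\<^sub>L k')" and k': "(k' o\<^sub>L k) + (k o\<^sub>L k') = 0"
  shows "i' Z + k (i' (k Z)) = j' (k Z) - k (j' Z)"
proof -
  have app: "k (k V) = - V" "k (j V) = - i V" "i (k V) = - j V" "k' (k V) = - k (k' V)" for V
    using arg_cong[OF kk, of "\<lambda>B. blinfun_apply B V"] arg_cong[OF kj, of "\<lambda>B. blinfun_apply B V"]
      arg_cong[OF ik, of "\<lambda>B. blinfun_apply B V"] arg_cong[OF k', of "\<lambda>B. blinfun_apply B V"]
    by (simp_all add: blinfun_apply_simps add_eq_0_iff2)
  show ?thesis by (simp add: i' app blinfun_apply_simps)
qed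

theorem lemma3p1:
  fixes n :: nat
    and M :: "'m topology"
    and \<A> :: "('m, 'e::euclidean_space) chart set"
    and g :: "('m, 'e) chart \<Rightarrow> 'e \<Rightarrow> 'e \<Rightarrow>\<^sub>L 'e \<Rightarrow>\<^sub>L real"
    and G :: "('m, 'e) chart \<Rightarrow> 'e \<Rightarrow> ('e \<Rightarrow>\<^sub>L 'e) set"
    and W :: "'m set"
    and I J K :: "('m, 'e) chart \<Rightarrow> 'e \<Rightarrow> 'e \<Rightarrow>\<^sub>L 'e"
    and c :: "('m, 'e) chart"
    and x X Y Z :: 'e
  assumes "almost_quaternion_hermitian n M \<A> g G"
    and "adapted_basis M \<A> g G W I J K"
    and "c \<in> \<A>" and "x \<in> chart_image c W"
  shows "nabla (g c) (omega (g c) (I c)) x X Y Z =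
      lambda_form n (g c) (K c) (I c) (J c) x X * omega (g c) (J c) x Y Z
      - lambda_form n (g c) (J c) (K c) (I c) x X * omega (g c) (K c) x Y Z
      + slot2 (J c x) (alpha_form n (g c) (K c) (I c) (J c) x) X Y Z
      - slot2 (K c x) (alpha_form n (g c) (J c) (K c) (I c) x) X Y Z"
proof -
  let ?h = "g c" and ?I = "I c" and ?J = "J c" and ?K = "K c" and ?S = "chart_image c W"
  have c: "is_chart M c" and metric: "riemannian_metric \<A> g"
    using assms(1,3) unfolding almost_quaternion_hermitian_def smooth_manifold_def by blast+
  have W: "openin M W" and
    smooth: "smooth_on ?S ?I" "smooth_on ?S ?J" "smooth_on ?S ?K"
    using assms(2,3) unfolding adapted_basis_def endomorphism_field_def by blast+
  have quat: "?I y o\<^sub>L ?I y = - id_blinfun" "?J y o\<^sub>L ?J y = - id_blinfun"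
    "?K y = ?I y o\<^sub>L ?J y" "?K y = - (?J y o\<^sub>L ?I y)" if "y \<in> ?S" for y
    using assms(2,3) that unfolding adapted_basis_def by blast+
  have orth: "?h x (?I x U) (?I x V) = ?h x U V" "?h x (?J x U) (?J x V) = ?h x U V"
    "?h x (?K x U) (?K x V) = ?h x U V" for U V
    using assms(2-4) unfolding adapted_basis_def by blast+
  have S: "open ?S" "x \<in> ?S" using open_chart_image[OF c W] assms(4) .
  have sub: "?S \<subseteq> snd c ` fst c" unfolding chart_image_def by blast
  have smooth_h: "smooth_on (snd c ` fst c) ?h"
    using metric assms(3) unfolding riemannian_metric_def by blast
  have sym: "?h y U V = ?h y V U" and pos: "U \<noteq> 0 \<Longrightarrow> ?h y U U > 0" if "y \<in> ?S" for y U V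
    using metric assms(3) that sub unfolding riemannian_metric_def by blast+
  have diff_h: "?h differentiable (at x)"
    using smooth_on_differentiable[OF smooth_h] S(2) sub by blast
  have lc: "levi_civita_at ?h x (christoffel ?h x)"
    by (rule levi_civita_christoffel[OF diff_h S]) (use sym pos S(2) in blast)+
  obtain I' J' K' where
    d: "(?I has_derivative I') (at x)" "(?J has_derivative J') (at x)" "(?K has_derivative K') (at x)"
    using smooth[THEN smooth_on_differentiable, OF S(2)] unfolding differentiable_def by metis
  define \<delta> where "\<delta> = cov_deriv (Blinfun (christoffel ?h x X))"
  let ?i = "\<delta> (?I x) (I' X)" and ?j = "\<delta> (?J x) (J' X)" and ?k = "\<delta> (?K x) (K' X)"
  \<comment> \<open>The rest of the multiplication table is needed on all of \<open>?S\<close>,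
    because some of these relations are differentiated below.\<close>
  have quat': "?K y o\<^sub>L ?K y = - id_blinfun" "?I y = ?J y o\<^sub>L ?K y" "?K y o\<^sub>L ?J y = - ?I y"
    "?I y o\<^sub>L ?K y = - ?J y" if "y \<in> ?S" for y
  proof -
    have II: "?I y (?I y V) = - V" and JJ: "?J y (?J y V) = - V" and
      K: "?K y V = ?I y (?J y V)" and JI': "?K y V = - ?J y (?I y V)" for V
      using quat[OF that, THEN arg_cong, of "\<lambda>B. blinfun_apply B V"]
      by (simp_all add: blinfun_apply_simps)
    have JI: "?J y (?I y V) = - ?I y (?J y V)" for V
      using K[of V] JI'[of V] by (metis minus_minus)
    show "?K y o\<^sub>L ?K y = - id_blinfun" "?I y = ?J y o\<^sub>L ?K y" "?K y o\<^sub>L ?J y = - ?I y"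
      "?I y o\<^sub>L ?K y = - ?J y"
      by (rule blinfun_eqI, simp add: K II JJ JI blinfun_apply_simps)+
  qed
  have dK: "(?k o\<^sub>L ?K x) + (?K x o\<^sub>L ?k) = 0"
    using cov_deriv_eq_compose[OF d(3) d(3) has_derivative_const S, of "- id_blinfun"] quat'(1)
      cov_deriv_minus_id unfolding \<delta>_def by metis
  have dI: "?i = (?j o\<^sub>L ?K x) + (?J x o\<^sub>L ?k)"
    unfolding \<delta>_def using cov_deriv_eq_compose[OF d(2) d(3) d(1) S] quat'(2) by blast
  have dJ: "(?j o\<^sub>L ?J x) + (?J x o\<^sub>L ?j) = 0"
    using cov_deriv_eq_compose[OF d(2) d(2) has_derivative_const S, of "- id_blinfun"] quat(2)
      cov_deriv_minus_id unfolding \<delta>_def by metis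
  have key: "?i V + ?K x (?i (?K x V)) = ?j (?K x V) - ?K x (?j V)" for V
    by (rule quaternion_derivation_identity[OF quat(2)[OF S(2)] quat'(1,3,4)[OF S(2)] dI dK])
  have nabla: "nabla ?h (omega ?h ?I) x X U V = ?h x U (?i V)"
    "nabla ?h (omega ?h ?J) x X U V = ?h x U (?j V)" for U V
    unfolding \<delta>_def by (rule nabla_omega[OF diff_h _ lc]; fact d)+
  have skew: "?h x (?I x U) V = - ?h x U (?I x V)" "?h x (?J x U) V = - ?h x U (?J x V)"
    "?h x (?K x U) V = - ?h x U (?K x V)" for U V
    using skew_of_orthogonal quat(1,2)[OF S(2)] quat'(1)[OF S(2)] orth by blast+
  \<comment> \<open>The \<open>slot3\<close> part of the \<alpha>-tensor with subscript
    \<open>K\<close> produces \<open>J j' I\<close>. Since \<open>j'\<close> anticommutes with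
    \<open>J\<close> and \<open>J I = - K\<close>, this is \<open>j' K\<close>.\<close>
  have JjI: "?J x (?j (?I x V)) = ?j (?K x V)" for V
  proof -
    have "?j (?J x (?I x V)) + ?J x (?j (?I x V)) = 0"
      using arg_cong[OF dJ, of "\<lambda>B. blinfun_apply B (?I x V)"] by (simp add: blinfun_apply_simps)
    moreover have "?J x (?I x V) = - ?K x V"
      using arg_cong[OF quat(4)[OF S(2)], of "\<lambda>B. blinfun_apply B V"]
      by (simp add: blinfun_apply_simps)
    ultimately show ?thesis by (simp add: blinfun_apply_simps)
  qed
  have IJ: "?I x (?J x V) = ?K x V" and KK: "?K x (?K x V) = - V" for V
    using arg_cong[OF quat(3)[OF S(2)], of "\<lambda>B. blinfun_apply B V"]
      arg_cong[OF quat'(1)[OF S(2)], of "\<lambda>B. blinfun_apply B V"]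
    by (simp_all add: blinfun_apply_simps)
  have "?h x Y (?i Z) + ?h x Y (?K x (?i (?K x Z))) =
      ?h x Y (?j (?K x Z)) - ?h x Y (?K x (?j Z))"
    using arg_cong[OF key[of Z], of "blinfun_apply (?h x Y)"] by (simp add: blinfun_apply_simps)
  \<comment> \<open>Skewness moves \<open>J\<close> and \<open>K\<close> from \<open>Y\<close> to
    the second argument of the metric. The \<lambda>-terms cancel and the goal becomes
    \<open>i' = (j' K - K j') / 2 + (i' - K i' K) / 2\<close>, paired with \<open>Y\<close>, which
    is \<open>key\<close> rearranged.\<close>
  then show ?thesis
    by (simp add: alpha_form_def slot2_def slot3_def nabla omega_def IJ KK skew(2,3) JjI
        blinfun_apply_simps field_simps)
qed

end
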